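(* Let $K$ be a locally compact normal Hausdorff space which is not compact, and let $\mathbb{X}$ be a Banach space over $\mathbb{K}\in\{\mathbb{R},\mathbb{C}\}$. Then $f\in C_0(K,\mathbb{X})$ is right symmetric in $C_0(K,\mathbb{X})$ if and only if $f$ is the zero function.
   Context: For a locally compact Hausdorff space $K$, $C_0(K,\mathbb{X})$ is the Banach space (supremum norm) of all bounded continuous functions $f:K\to\mathbb{X}$ such that for every $\epsilon>0$ there is a compact set $\Gamma\subset K$ with $\|f(k)\|<\epsilon$ for all $k\in K\setminus\Gamma$. For a Banach space $\mathbb{Z}$ over $\mathbb{K}$ and $x,y\in\mathbb{Z}$, $x\perp_B y$ (Birkhoff-James orthogonality) means $\|x+\lambda y\|\ge\|x\|$ for all $\lambda\in\mathbb{K}$. A point $x\in\mathbb{Z}$ is right symmetric (in $\mathbb{Z}$) if for all $y\in\mathbb{Z}$, $y\perp_B x$ implies $x\perp_B y$. *)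

theory Defs
  imports "HOL-Analysis.Analysis"
begin

text \<open>
  A complex normed space is a real normed space together with a complex scalar multiplication
  that extends the real one and for which the norm is absolutely homogeneous. Every complex
  normed space arises in this way from its underlying real space. A complex Banach space is
  obtained by taking the carrier type in class \<open>banach\<close>, as completeness only concerns the norm.
\<close>

locale complex_normed_space = vector_space scaleC
  for scaleC :: "complex \<Rightarrow> 'x::real_normed_vector \<Rightarrow> 'x" +
  assumes scaleC_of_real: "scaleC (of_real r) x = r *\<^sub>R x"
    and norm_scaleC: "norm (scaleC c x) = norm c * norm x"

text \<open>
  The scalar multiplication \<open>s\<close> is explicit because the notion depends on the scalar field: over
  the complex numbers, \<open>c\<close> ranges over a larger set than over the reals.
\<close>

definition birkhoff_james :: "('s \<Rightarrow> 'z::real_normed_vector \<Rightarrow> 'z) \<Rightarrow> 'z \<Rightarrow> 'z \<Rightarrow> bool" where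
  "birkhoff_james s x y \<longleftrightarrow> (\<forall>c. norm (x + s c y) \<ge> norm x)"

text \<open>Right symmetry in the subspace \<open>Z\<close> of the ambient normed space: only \<open>y \<in> Z\<close> are tested.\<close>

definition right_symmetric ::
  "('s \<Rightarrow> 'z::real_normed_vector \<Rightarrow> 'z) \<Rightarrow> 'z set \<Rightarrow> 'z \<Rightarrow> bool" where
  "right_symmetric s Z x \<longleftrightarrow>
     x \<in> Z \<and> (\<forall>y\<in>Z. birkhoff_james s y x \<longrightarrow> birkhoff_james s x y)"

definition C0 :: "('k::topological_space \<Rightarrow>\<^sub>C 'x::real_normed_vector) set" where
  "C0 = {f. \<forall>\<epsilon>>0. \<exists>\<Gamma>. compact \<Gamma> \<and> (\<forall>k. k \<notin> \<Gamma> \<longrightarrow> norm (apply_bcontfun f k) < \<epsilon>)}"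

text \<open>
  Pointwise scalar multiplication. It is only meaningful if every \<open>s c\<close> is continuous and maps
  bounded sets to bounded sets; lemma \<open>apply_bcontfun_scale\<close> below shows that this is so for
  complex normed spaces.
\<close>

definition bcontfun_scale ::
  "('s \<Rightarrow> 'x \<Rightarrow> 'x) \<Rightarrow> 's \<Rightarrow> ('k::topological_space \<Rightarrow>\<^sub>C 'x::real_normed_vector) \<Rightarrow> ('k \<Rightarrow>\<^sub>C 'x)" where
  "bcontfun_scale s c f = Bcontfun (\<lambda>k. s c (apply_bcontfun f k))"

lemma C0E:
  assumes "f \<in> C0" and "e > 0"
  obtains A where "compact A" and "\<And>k. k \<notin> A \<Longrightarrow> norm (apply_bcontfun f k) < e"
proof -
  have "\<exists>A. compact A \<and> (\<forall>k. k \<notin> A \<longrightarrow> norm (apply_bcontfun f k) < e)"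
    using assms(1)[unfolded C0_def mem_Collect_eq, rule_format, OF assms(2)] .
  then show thesis using that by blast
qed

lemma C0_subspace: "subspace (C0 :: ('k::topological_space \<Rightarrow>\<^sub>C 'x::real_normed_vector) set)"
proof (rule subspaceI)
  show "0 \<in> (C0 :: ('k \<Rightarrow>\<^sub>C 'x) set)"
    by (auto simp: C0_def intro: exI[of _ "{}"])
next
  fix f g :: "'k \<Rightarrow>\<^sub>C 'x"
  assume fg: "f \<in> C0" "g \<in> C0"
  show "f + g \<in> C0"
    unfolding C0_def
  proof (intro CollectI allI impI)
    fix e :: real assume "e > 0"
    then have e2: "e / 2 > 0" by simp
    obtain A where A: "compact A" "\<And>k. k \<notin> A \<Longrightarrow> norm (f k) < e / 2"
      using C0E[OF fg(1) e2] by metis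
    obtain B where B: "compact B" "\<And>k. k \<notin> B \<Longrightarrow> norm (g k) < e / 2"
      using C0E[OF fg(2) e2] by metis
    have "norm ((f + g) k) < e" if "k \<notin> A \<union> B" for k
    proof -
      have "norm (f k) < e / 2" "norm (g k) < e / 2" using A(2) B(2) that by blast+
      then show ?thesis using norm_triangle_ineq[of "f k" "g k"] by simp
    qed
    with A(1) B(1) show "\<exists>\<Gamma>. compact \<Gamma> \<and> (\<forall>k. k \<notin> \<Gamma> \<longrightarrow> norm ((f + g) k) < e)"
      by (intro exI[of _ "A \<union> B"] conjI compact_Un) auto
  qed
next
  fix c :: real and f :: "'k \<Rightarrow>\<^sub>C 'x"
  assume f: "f \<in> C0"
  show "c *\<^sub>R f \<in> C0"
    unfolding C0_def
  proof (intro CollectI allI impI)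
    fix e :: real assume e: "e > 0"
    then have e': "e / (\<bar>c\<bar> + 1) > 0" by simp
    obtain A where A: "compact A" "\<And>k. k \<notin> A \<Longrightarrow> norm (f k) < e / (\<bar>c\<bar> + 1)"
      using C0E[OF f e'] by metis
    have "\<bar>c\<bar> * norm (f k) < e" if "k \<notin> A" for k
    proof -
      have "\<bar>c\<bar> * norm (f k) \<le> (\<bar>c\<bar> + 1) * norm (f k)" by (simp add: mult_right_mono)
      also have "\<dots> < e" using A(2)[OF that] by (simp add: field_simps)
      finally show ?thesis .
    qed
    with A(1) show "\<exists>\<Gamma>. compact \<Gamma> \<and> (\<forall>k. k \<notin> \<Gamma> \<longrightarrow> norm ((c *\<^sub>R f) k) < e)"
      by (intro exI[of _ A]) simp
  qed
qed

lemma C0_closed: "closed (C0 :: ('k::topological_space \<Rightarrow>\<^sub>C 'x::real_normed_vector) set)"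
  unfolding closed_sequential_limits
proof (intro allI impI, elim conjE)
  fix F :: "nat \<Rightarrow> 'k \<Rightarrow>\<^sub>C 'x" and f
  assume F: "\<forall>n. F n \<in> C0" and lim: "F \<longlonglongrightarrow> f"
  show "f \<in> C0"
    unfolding C0_def
  proof (intro CollectI allI impI)
    fix e :: real assume e: "e > 0"
    then have e2: "e / 2 > 0" by simp
    obtain n where n: "dist (F n) f < e / 2"
      using metric_LIMSEQ_D[OF lim e2] by blast
    obtain A where A: "compact A" "\<And>k. k \<notin> A \<Longrightarrow> norm (F n k) < e / 2"
      using C0E[OF F[rule_format, of n] e2] by metis
    have "norm (f k) < e" if "k \<notin> A" for k
    proof -
      have "dist (f k) (F n k) < e / 2"
        using dist_bounded[of "F n" k f] n by (simp add: dist_commute)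
      then have "norm (f k - F n k) < e / 2" by (simp add: dist_norm)
      then show ?thesis
        using A(2)[OF that] norm_triangle_ineq[of "f k - F n k" "F n k"] by simp
    qed
    with A(1) show "\<exists>\<Gamma>. compact \<Gamma> \<and> (\<forall>k. k \<notin> \<Gamma> \<longrightarrow> norm (f k) < e)" by blast
  qed
qed

context complex_normed_space
begin

lemma bounded_linear_scaleC: "bounded_linear (scaleC c)"
proof (rule bounded_linear_intro)
  show "scaleC c (r *\<^sub>R x) = r *\<^sub>R scaleC c x" for r x
    by (metis scaleC_of_real scale_left_commute)
  show "norm (scaleC c x) \<le> norm x * norm c" for x
    by (simp add: norm_scaleC)
qed (rule scale_right_distrib)

lemma apply_bcontfun_scale:
  "apply_bcontfun (bcontfun_scale scaleC c f) k = scaleC c (apply_bcontfun f k)"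
proof -
  have "(\<lambda>k. scaleC c (f k)) \<in> bcontfun"
  proof (rule bcontfun_normI)
    show "continuous_on UNIV (\<lambda>k. scaleC c (f k))"
      by (intro bounded_linear.continuous_on[OF bounded_linear_scaleC]) simp
    show "norm (scaleC c (f k)) \<le> norm c * norm f" for k
      by (simp add: norm_scaleC norm_bounded mult_left_mono)
  qed
  then show ?thesis
    by (simp add: bcontfun_scale_def Bcontfun_inverse)
qed

end

end

theory Submission
  imports Defs
begin

text \<open>
  If \<open>f \<noteq> 0\<close>, non-compactness yields a point \<open>p\<close> with \<open>\<parallel>f p\<parallel> < \<parallel>f\<parallel> / 2\<close>. Near \<open>p\<close>, \<open>f\<close> is deformed by a
  bump function into a vector of norm \<open>\<parallel>f\<parallel>\<close> pointing opposite to \<open>f p\<close>. The result \<open>y\<close> still has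
  norm at most \<open>\<parallel>f\<parallel>\<close>. It is orthogonal to \<open>f\<close>: perturbations by \<open>c f\<close> with \<open>Re c \<ge> 0\<close> are detected
  where \<open>\<parallel>f\<parallel>\<close> is almost attained, those with \<open>Re c \<le> 0\<close> at \<open>p\<close>. But \<open>f\<close> is not orthogonal to \<open>y\<close>,
  because \<open>\<parallel>f - y / 4\<parallel> \<le> 3/4 \<parallel>f\<parallel>\<close>: where \<open>y \<noteq> f\<close>, the norm of \<open>f\<close> is below \<open>\<parallel>f\<parallel> / 2\<close>.
\<close>

text \<open>Transfers normality from the type class to the predicate on which
  \<open>Urysohn_lemma\<close> is stated.\<close>

lemma normal_space_euclidean: "normal_space (euclidean :: 'a::t4_space topology)"
  unfolding normal_space_def
proof (intro allI impI, elim conjE)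
  fix S T :: "'a set"
  assume "closedin euclidean S" "closedin euclidean T" "disjnt S T"
  then have "closed S" "closed T" "S \<inter> T = {}"
    by (auto simp: disjnt_def)
  then show "\<exists>U V. openin euclidean U \<and> openin euclidean V \<and> S \<subseteq> U \<and> T \<subseteq> V \<and> disjnt U V"
    using t4_space[of S T] by (simp add: disjnt_def)
qed

text \<open>Urysohn's lemma separates \<open>p\<close> from the complement of
  \<open>U \<inter> V\<close>, where \<open>V\<close> is a neighbourhood of \<open>p\<close> inside
  a compact \<open>N\<close>. Vanishing off \<open>N\<close> is what later keeps the deformed
  function in \<open>C0\<close>.\<close>

lemma compactly_supported_bump:
  fixes p :: "'k::t4_space"
  assumes lc: "locally_compact_space (euclidean :: 'k topology)"
    and "open U" "p \<in> U"
  obtains b :: "'k \<Rightarrow> real" and N where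
    "continuous_on UNIV b" "\<And>k. 0 \<le> b k" "\<And>k. b k \<le> 1" "b p = 1"
    "\<And>k. k \<notin> U \<Longrightarrow> b k = 0" "compact N" "\<And>k. k \<notin> N \<Longrightarrow> b k = 0"
proof -
  obtain V N where V: "open V" "compact N" "p \<in> V" "V \<subseteq> N"
    using lc that unfolding locally_compact_space_def
    by (auto dest!: spec[of _ p])
  have "closedin euclidean (- (U \<inter> V))" "closedin euclidean {p}" "disjnt (- (U \<inter> V)) {p}"
    using assms V by (auto simp: disjnt_def)
  then obtain b where b: "continuous_map euclidean (top_of_set {0..1::real}) b"
      "b ` (- (U \<inter> V)) \<subseteq> {0}" "b ` {p} \<subseteq> {1}"
    using Urysohn_lemma[OF normal_space_euclidean, of "- (U \<inter> V)" "{p}" 0 1] by auto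
  have "continuous_on UNIV b" and range: "\<And>k. b k \<in> {0..1}"
    using b(1) by (auto simp: continuous_map_in_subtopology)
  moreover have "b k = 0" if "k \<notin> U \<or> k \<notin> N" for k
    using b(2) that V(4) by blast
  ultimately show thesis
    using that[of b N] b(3) V(2) by auto
qed

text \<open>
  In the application, \<open>s\<close> and \<open>S\<close> are scalar multiplication in \<open>'x\<close> and its pointwise lift to
  functions. Hypothesis \<open>dich\<close> is the case distinction on the sign of the real part of \<open>c\<close>.
\<close>

lemma not_right_symmetric_C0:
  fixes f :: "'k::t4_space \<Rightarrow>\<^sub>C 'x::real_normed_vector"
    and s :: "'s \<Rightarrow> 'x \<Rightarrow> 'x"
    and S :: "'s \<Rightarrow> ('k \<Rightarrow>\<^sub>C 'x) \<Rightarrow> 'k \<Rightarrow>\<^sub>C 'x"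
  assumes lc: "locally_compact_space (euclidean :: 'k topology)"
    and nc: "\<not> compact (UNIV :: 'k set)"
    and S: "\<And>c h k. S c h k = s c (h k)"
    and dich: "\<And>c. (\<forall>x. \<forall>r\<ge>0. norm x \<le> norm (x + s c (r *\<^sub>R x))) \<or>
                    (\<forall>x. \<forall>r\<le>0. norm x \<le> norm (x + s c (r *\<^sub>R x)))"
    and t: "\<And>x. s t x = (-1/4) *\<^sub>R x"
    and f: "f \<in> C0" and "f \<noteq> 0"
  shows "\<not> right_symmetric S C0 f"
proof -
  define n where "n = norm f"
  have n: "n > 0" using \<open>f \<noteq> 0\<close> by (simp add: n_def)
  have fn: "norm (f k) \<le> n" for k by (simp add: n_def norm_bounded)
  obtain A where "compact A" and A: "\<And>k. k \<notin> A \<Longrightarrow> norm (f k) < n / 2"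
    using C0E[OF f, of "n / 2"] n by auto
  then obtain p where "p \<notin> A" using nc by (metis UNIV_eq_I)
  then have p: "norm (f p) < n / 2" by (rule A)
  have "open {k. norm (f k) < n / 2}"
    by (intro open_Collect_less continuous_intros) auto
  then obtain b :: "'k \<Rightarrow> real" and N where b:
      "continuous_on UNIV b" "\<And>k. 0 \<le> b k" "\<And>k. b k \<le> 1" "b p = 1"
      "\<And>k. \<not> norm (f k) < n / 2 \<Longrightarrow> b k = 0" "compact N" "\<And>k. k \<notin> N \<Longrightarrow> b k = 0"
    using compactly_supported_bump[OF lc, of "{k. norm (f k) < n / 2}" p] p
    unfolding mem_Collect_eq by blast
  \<comment> \<open>If \<open>f p = 0\<close>, any vector of norm \<open>n\<close> serves with
    \<open>r = 0\<close>; a nonzero value of \<open>f\<close> is rescaled to give one.\<close>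
  obtain v r where v: "norm v = n" "r \<le> 0" "f p = r *\<^sub>R v"
  proof (cases "f p = 0")
    case True
    obtain q where "f q \<noteq> 0" using \<open>f \<noteq> 0\<close> by (metis bcontfun_eqI zero_bcontfun.rep_eq)
    then show thesis using that[of "(n / norm (f q)) *\<^sub>R f q" 0] True n by simp
  next
    case False
    then show thesis
      using that[of "(- n / norm (f p)) *\<^sub>R f p" "- norm (f p) / n"] n by simp
  qed
  define Y where "Y k = (1 - b k) *\<^sub>R f k + b k *\<^sub>R v" for k
  have Yn: "norm (Y k) \<le> n" for k
  proof -
    have "norm (Y k) \<le> (1 - b k) * norm (f k) + b k * norm v"
      unfolding Y_def using norm_triangle_ineq[of "(1 - b k) *\<^sub>R f k" "b k *\<^sub>R v"] b(2,3)[of k] by simp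
    also have "\<dots> \<le> n"
      using b(2,3)[of k] fn[of k] v(1) by (intro convex_bound_le) auto
    finally show ?thesis .
  qed
  have "Y \<in> bcontfun"
  proof (rule bcontfun_normI)
    show "continuous_on UNIV Y"
      unfolding Y_def by (intro continuous_intros b(1)) auto
  qed (rule Yn)
  then obtain y where y: "\<And>k. apply_bcontfun y k = Y k"
    by (metis Bcontfun_inverse)
  have yC0: "y \<in> C0"
    unfolding C0_def
  proof (intro CollectI allI impI)
    fix e :: real assume "e > 0"
    then obtain B where B: "compact B" "\<And>k. k \<notin> B \<Longrightarrow> norm (f k) < e"
      using C0E[OF f] by metis
    have "norm (y k) < e" if "k \<notin> B \<union> N" for k
      using that B(2)[of k] b(7)[of k] by (simp add: y Y_def)
    then show "\<exists>\<Gamma>. compact \<Gamma> \<and> (\<forall>k. k \<notin> \<Gamma> \<longrightarrow> norm (y k) < e)"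
      using B(1) b(6) by (intro exI[of _ "B \<union> N"]) auto
  qed
  have yn: "norm y \<le> n" by (rule norm_bound) (simp add: y Yn)
  have "birkhoff_james S y f"
    unfolding birkhoff_james_def
  proof
    fix c
    define M where "M = norm (y + S c f)"
    have M: "norm (Y k + s c (f k)) \<le> M" for k
      using norm_bounded[of "y + S c f" k] by (simp add: M_def y S)
    have "n \<le> M"
      using dich[of c]
    proof
      assume *: "\<forall>x. \<forall>r\<ge>0. norm x \<le> norm (x + s c (r *\<^sub>R x))"
      \<comment> \<open>Where \<open>norm (f k) \<ge> n / 2\<close>, the bump vanishes and
        \<open>Y k = f k\<close>. The bound covers all \<open>k\<close>, so it passes to the
        supremum \<open>n\<close>; as \<open>n / 2 < n\<close>, the maximum must be
        \<open>M\<close>.\<close>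
      have "norm (f k) \<le> max M (n / 2)" for k
      proof (cases "norm (f k) < n / 2")
        case False
        have "norm (f k) \<le> norm (f k + s c (f k))"
          using *[rule_format, of 1 "f k"] by simp
        also have "\<dots> \<le> M" using M[of k] b(5)[OF False] by (simp add: Y_def)
        finally show ?thesis by simp
      qed simp
      then have "n \<le> max M (n / 2)" unfolding n_def by (rule norm_bound)
      with n show ?thesis by (auto simp: max_def split: if_splits)
    next
      assume *: "\<forall>x. \<forall>r\<le>0. norm x \<le> norm (x + s c (r *\<^sub>R x))"
      then have "norm v \<le> norm (v + s c (r *\<^sub>R v))" using v(2) by blast
      then show ?thesis using M[of p] b(4) v by (simp add: Y_def)
    qed
    with yn show "norm y \<le> norm (y + S c f)" by (simp add: M_def)
  qed
  moreover have "\<not> birkhoff_james S f y"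
  proof -
    \<comment> \<open>Off the bump, \<open>f - f / 4\<close> has norm at most
      \<open>3 / 4 * n\<close>; where \<open>norm (f k) < n / 2\<close>, the triangle inequality
      gives \<open>n / 2 + n / 4\<close>.\<close>
    have "norm ((f + S t y) k) \<le> 3 / 4 * n" for k
    proof (cases "norm (f k) < n / 2")
      case True
      have "norm ((f + S t y) k) \<le> norm (f k) + norm (Y k) / 4"
        using norm_triangle_ineq[of "f k" "(-1/4) *\<^sub>R Y k"] by (simp add: S t y)
      with True Yn[of k] show ?thesis by simp
    next
      case False
      then have "(f + S t y) k = (3 / 4) *\<^sub>R f k"
        using b(5)[OF False] scaleR_left.add[of 1 "- 1 / 4" "f k"] by (simp add: S t y Y_def)
      with fn[of k] show ?thesis by simp
    qed
    then have "norm (f + S t y) \<le> 3 / 4 * n" by (rule norm_bound)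
    with n have "norm (f + S t y) < norm f" unfolding n_def by linarith
    then show ?thesis unfolding birkhoff_james_def by (metis not_le)
  qed
  ultimately show ?thesis
    using yC0 unfolding right_symmetric_def by blast
qed

lemma right_symmetric_C0_zero: "right_symmetric s C0 0"
  by (simp add: right_symmetric_def birkhoff_james_def subspace_0[OF C0_subspace])

text \<open>The sum is \<open>x\<close> scaled by \<open>1 + c * r\<close>, which is at least 1 once
  \<open>c\<close> and \<open>r\<close> agree in sign.\<close>

lemma scaleR_dichotomy:
  fixes c :: real
  shows "(\<forall>x::'x::real_normed_vector. \<forall>r\<ge>0. norm x \<le> norm (x + c *\<^sub>R r *\<^sub>R x)) \<or>
         (\<forall>x::'x. \<forall>r\<le>0. norm x \<le> norm (x + c *\<^sub>R r *\<^sub>R x))"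
proof -
  have "norm x \<le> norm (x + c *\<^sub>R r *\<^sub>R x)" if "0 \<le> c * r" for x :: 'x and r
  proof -
    have "x + c *\<^sub>R r *\<^sub>R x = (1 + c * r) *\<^sub>R x" by (simp add: scaleR_left_distrib)
    then show ?thesis using that mult_right_mono[of 1 "1 + c * r" "norm x"] by simp
  qed
  then show ?thesis by (meson linear mult_nonneg_nonneg mult_nonpos_nonpos)
qed

text \<open>As in the real case, since the modulus of \<open>1 + c * of_real r\<close> is at least
  its real part \<open>1 + Re c * r\<close>.\<close>

lemma (in complex_normed_space) scaleC_dichotomy:
  "(\<forall>x. \<forall>r\<ge>0. norm x \<le> norm (x + scaleC c (r *\<^sub>R x))) \<or>
   (\<forall>x. \<forall>r\<le>0. norm x \<le> norm (x + scaleC c (r *\<^sub>R x)))"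
proof -
  have "norm x \<le> norm (x + scaleC c (r *\<^sub>R x))" if "0 \<le> Re c * r" for x r
  proof -
    have "x + scaleC c (r *\<^sub>R x) = scaleC (1 + c * of_real r) x"
      by (simp add: scale_left_distrib flip: scaleC_of_real)
    moreover have "1 \<le> cmod (1 + c * of_real r)"
      using complex_Re_le_cmod[of "1 + c * of_real r"] that by simp
    ultimately show ?thesis
      using mult_right_mono[of 1 "cmod (1 + c * of_real r)" "norm x"] by (simp add: norm_scaleC)
  qed
  then show ?thesis by (meson linear mult_nonneg_nonneg mult_nonpos_nonpos)
qed

theorem theorem3p15:
  fixes f :: "'k::t4_space \<Rightarrow>\<^sub>C 'x::banach"
    and g :: "'k \<Rightarrow>\<^sub>C 'y::banach"
    and scaleC :: "complex \<Rightarrow> 'y \<Rightarrow> 'y"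
  assumes "locally_compact_space (euclidean :: 'k topology)"
    and "\<not> compact (UNIV :: 'k set)"
  shows "(f \<in> C0 \<longrightarrow> (right_symmetric scaleR C0 f \<longleftrightarrow> f = 0)) \<and>
         (complex_normed_space scaleC \<and> g \<in> C0 \<longrightarrow>
           (right_symmetric (bcontfun_scale scaleC) C0 g \<longleftrightarrow> g = 0))"
proof (intro conjI impI; (elim conjE)?)
  assume "f \<in> C0"
  then have "\<not> right_symmetric scaleR C0 f" if "f \<noteq> 0"
    using that
    by (intro not_right_symmetric_C0[OF assms, of scaleR scaleR "-1/4"] scaleR_dichotomy) auto
  then show "right_symmetric scaleR C0 f \<longleftrightarrow> f = 0"
    using right_symmetric_C0_zero by metis
next
  assume "complex_normed_space scaleC" and g: "g \<in> C0"
  then interpret complex_normed_space scaleC by simp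
  have "\<not> right_symmetric (bcontfun_scale scaleC) C0 g" if "g \<noteq> 0"
    using that g
    by (intro not_right_symmetric_C0[OF assms, of _ scaleC "of_real (-1/4)"]
        scaleC_dichotomy apply_bcontfun_scale scaleC_of_real)
  then show "right_symmetric (bcontfun_scale scaleC) C0 g \<longleftrightarrow> g = 0"
    using right_symmetric_C0_zero by metis
qed

end
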